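(* Let $0\le a\le b$ and $d>0$, and let $\mathbf{D}=[\mathbf{A}\ \mathbf{B}]\in\mathbb{C}^{M\times N}$ be any dictionary in the set $\mathcal{D}(d,a,b)$, i.e., a dictionary with coherence $d$ that is the concatenation of a sub-dictionary $\mathbf{A}$ with coherence $a$ and a sub-dictionary $\mathbf{B}$ with coherence $b$. Define $$f(x)=\frac{(1+a)(1+b)-xb(1+a)}{x(d^2-ab)+a(1+b)},\qquad x_b=\frac{1+b}{b+d^2},$$ $$x_s=\begin{cases}1/d, & \text{if } a=b=d,\\[4pt] \dfrac{d\sqrt{(1+a)(1+b)}-a-ab}{d^2-ab}, & \text{otherwise,}\end{cases}$$ and $\hat{x}=\min\{x_b,x_s\}$. Then $$\mathrm{spark}(\mathbf{D})\ \ge\ \hat{x}+f(\hat{x}).$$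
   Context: A dictionary is a matrix $\mathbf{D}=[\mathbf{d}_1\ \ldots\ \mathbf{d}_N]\in\mathbb{C}^{M\times N}$ whose columns have unit $\ell_2$-norm and span $\mathbb{C}^M$. A sub-dictionary is a (nonempty) matrix with unit $\ell_2$-norm columns in $\mathbb{C}^M$, not required to span $\mathbb{C}^M$. The coherence of a matrix with unit-norm columns $\mathbf{d}_i$ is $\max_{i\ne j}|\mathbf{d}_i^H\mathbf{d}_j|$, and it is set to $0$ if there is only one column. $\mathcal{D}(d,a,b)$ denotes the set of dictionaries $\mathbf{D}=[\mathbf{A}\ \mathbf{B}]$ with coherence $d$, where the sub-dictionary $\mathbf{A}$ has coherence $a$ and the sub-dictionary $\mathbf{B}$ has coherence $b$; $\mathbf{A}$ and $\mathbf{B}$ need not be orthonormal bases and need not have the same number of columns. (Automatically $a,b\le d\le 1$.) The spark of $\mathbf{D}$ is the cardinality of the smallest set of linearly dependent columns of $\mathbf{D}$ (with $\mathrm{spark}(\mathbf{D})=+\infty$ if there is no such set). *)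

theory Defs
  imports "HOL-Analysis.Analysis"
begin

text \<open>
  A matrix in \<open>\<complex>\<^bsup>M\<times>N\<^esup>\<close> is an element of \<open>complex ^ 'n ^ 'm\<close> with \<open>M = CARD('m)\<close> and
  \<open>N = CARD('n)\<close>. The norm on \<open>complex ^ 'm\<close> is the \<open>\<ell>\<^sub>2\<close>-norm. The inner product and the
  unqualified \<^const>\<open>span\<close> on this type are those of the underlying real space; hence
  the Hermitian product below, and the complex span \<open>vec.span\<close>.
\<close>

definition hermitian_prod :: "complex ^ 'm \<Rightarrow> complex ^ 'm \<Rightarrow> complex" where
  "hermitian_prod x y = (\<Sum>k\<in>UNIV. cnj (x $ k) * y $ k)"

definition sub_dictionary :: "complex ^ 'n ^ 'm \<Rightarrow> bool" where
  "sub_dictionary D \<longleftrightarrow> (\<forall>i. norm (column i D) = 1)"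

definition dictionary :: "complex ^ 'n ^ 'm \<Rightarrow> bool" where
  "dictionary D \<longleftrightarrow> sub_dictionary D \<and> vec.span (columns D) = UNIV"

definition coherence :: "complex ^ 'n ^ 'm \<Rightarrow> real" where
  "coherence D =
     (if CARD('n) = 1 then 0
      else Max {cmod (hermitian_prod (column i D) (column j D)) | i j. i \<noteq> j})"

text \<open>The concatenation \<open>[A B]\<close>; its columns are indexed by the disjoint sum.\<close>

definition hconcat :: "complex ^ 'p ^ 'm \<Rightarrow> complex ^ 'q ^ 'm \<Rightarrow> complex ^ ('p::finite + 'q::finite) ^ 'm" where
  "hconcat A B = (\<chi> i j. case j of Inl k \<Rightarrow> A $ i $ k | Inr k \<Rightarrow> B $ i $ k)"

definition dictionaries :: "real \<Rightarrow> real \<Rightarrow> real \<Rightarrow> (complex ^ ('p::finite + 'q::finite) ^ 'm) set" where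
  "dictionaries d a b =
     {D. dictionary D \<and> coherence D = d \<and>
         (\<exists>A B. D = hconcat A B \<and>
                sub_dictionary A \<and> coherence A = a \<and>
                sub_dictionary B \<and> coherence B = b)}"

text \<open>
  Dependence is that of the indexed family of columns, so that two equal columns in
  different positions are dependent; \<open>vec.dependent\<close> applied to the set of columns would
  identify them.
\<close>

definition dependent_columns :: "complex ^ 'n ^ 'm \<Rightarrow> 'n set \<Rightarrow> bool" where
  "dependent_columns D S \<longleftrightarrow>
     (\<exists>c. (\<exists>i\<in>S. c i \<noteq> 0) \<and> (\<Sum>i\<in>S. c i *s column i D) = 0)"

text \<open>The infimum of the empty set in \<^typ>\<open>enat\<close> is \<open>\<infinity>\<close>.\<close>

definition spark :: "complex ^ 'n ^ 'm \<Rightarrow> enat" where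
  "spark D = (INF S \<in> {S. dependent_columns D S}. enat (card S))"

definition f_fun :: "real \<Rightarrow> real \<Rightarrow> real \<Rightarrow> real \<Rightarrow> real" where
  "f_fun d a b x = ((1 + a) * (1 + b) - x * b * (1 + a)) / (x * (d\<^sup>2 - a * b) + a * (1 + b))"

definition x_b :: "real \<Rightarrow> real \<Rightarrow> real" where
  "x_b d b = (1 + b) / (b + d\<^sup>2)"

definition x_s :: "real \<Rightarrow> real \<Rightarrow> real \<Rightarrow> real" where
  "x_s d a b =
     (if a = b \<and> b = d then 1 / d
      else (d * sqrt ((1 + a) * (1 + b)) - a - a * b) / (d\<^sup>2 - a * b))"

definition x_hat :: "real \<Rightarrow> real \<Rightarrow> real \<Rightarrow> real" where
  "x_hat d a b = min (x_b d b) (x_s d a b)"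

end

theory Submission imports Defs begin

text \<open>
  Pairing a vanishing combination of \<open>p\<close> columns of \<open>A\<close> and \<open>q\<close> columns of \<open>B\<close> with each of
  these columns, and adding up the moduli, gives two linear inequalities between the
  \<open>\<ell>\<^sub>1\<close>-norms of the two coefficient vectors. If both norms are positive, eliminating them yields
  \<open>(1 + a - a p) (1 + b - b q) \<le> p q d\<^sup>2\<close> or \<open>1 + a \<le> a p\<close> or \<open>1 + b \<le> b q\<close>, where the
  first alternative means \<open>p \<ge> f q\<close>. In terms of \<open>u = x (d\<^sup>2 - a b) + a (1 + b)\<close>, the function
  \<open>x + f x\<close> is affine in \<open>u + K / u\<close> with \<open>K = d\<^sup>2 (1 + a) (1 + b)\<close>, so it decreases up to its
  minimum at \<open>u = sqrt K\<close>, that is, at \<open>x\<^sub>s\<close>. Since \<open>f x\<^sub>b = 1\<close>, the constraint \<open>p \<ge> 1\<close> cuts off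
  the range beyond \<open>x\<^sub>b\<close>.
\<close>

subsection \<open>Minimizing \<open>x + f x\<close>\<close>

text \<open>The right side minus the left side is
  \<open>(t - u) * (s\<^sup>2 - u * t) / (u * t)\<close>. For \<open>t = s\<close> its numerator is
  a nonnegative multiple of a square; for \<open>u \<le> t \<le> s\<close> both factors are
  nonnegative.\<close>

lemma add_divide_mono_below_sqrt:
  fixes t u s :: real
  assumes "0 < u" "0 < t" and "t = s \<or> (u \<le> t \<and> t \<le> s)"
  shows "t + s\<^sup>2 / t \<le> u + s\<^sup>2 / u"
proof -
  have "0 \<le> (t - u) * (s\<^sup>2 - u * t)"
    using assms(3)
  proof
    assume "t = s"
    then have "(t - u) * (s\<^sup>2 - u * t) = s * (s - u)\<^sup>2"
      by (simp add: power2_eq_square algebra_simps)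
    then show ?thesis using \<open>t = s\<close> assms by simp
  next
    assume *: "u \<le> t \<and> t \<le> s"
    have "u * t \<le> s * s" using * assms by (intro mult_mono) auto
    then show ?thesis using * by (simp add: power2_eq_square)
  qed
  then have "0 \<le> (t - u) * (s\<^sup>2 - u * t) / (u * t)"
    using assms by simp
  also have "\<dots> = (u + s\<^sup>2 / u) - (t + s\<^sup>2 / t)"
    using assms by (simp add: field_simps power2_eq_square)
  finally show ?thesis by simp
qed

text \<open>The denominator of \<open>f_fun\<close> is \<open>u\<close>, and its numerator is affine
  in \<open>u\<close> because \<open>x\<close> is; the quotient is therefore a constant plus a
  multiple of \<open>1 / u\<close>.\<close>

lemma add_f_fun_eq:
  assumes "d\<^sup>2 - a * b \<noteq> 0" and "u = x * (d\<^sup>2 - a * b) + a * (1 + b)" and "u \<noteq> 0"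
  shows "x + f_fun d a b x =
    (u + d\<^sup>2 * (1 + a) * (1 + b) / u - a * (1 + b) - b * (1 + a)) / (d\<^sup>2 - a * b)"
proof -
  define e where "e = d\<^sup>2 - a * b"
  have d: "d\<^sup>2 = e + a * b" by (simp add: e_def)
  have "e \<noteq> 0" using assms by (simp add: e_def)
  have x: "x = (u - a * (1 + b)) / e"
    using assms \<open>e \<noteq> 0\<close> by (simp add: e_def)
  have "f_fun d a b x = ((1 + a) * (1 + b) - x * b * (1 + a)) / u"
    using assms by (simp add: f_fun_def)
  also have "\<dots> = ((e + a * b) * (1 + a) * (1 + b) / u - b * (1 + a)) / e"
    using \<open>u \<noteq> 0\<close> \<open>e \<noteq> 0\<close> unfolding x by (simp add: field_simps)
  finally show ?thesis
    unfolding d using \<open>e \<noteq> 0\<close> by (simp add: x diff_divide_distrib add_divide_distrib)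
qed

text \<open>Numerator and denominator agree at \<open>x_b\<close>, and their common value is
  positive because \<open>0 < d\<close>.\<close>

lemma f_fun_x_b:
  assumes "0 \<le> a" "0 \<le> b" "0 < d"
  shows "f_fun d a b (x_b d b) = 1"
proof -
  have *: "b + d\<^sup>2 > 0" using assms by (simp add: add_nonneg_pos)
  have num: "(1 + a) * (1 + b) - x_b d b * b * (1 + a) = (1 + a) * (1 + b) * d\<^sup>2 / (b + d\<^sup>2)"
    using * by (simp add: x_b_def field_simps)
  have den: "x_b d b * (d\<^sup>2 - a * b) + a * (1 + b) = (1 + a) * (1 + b) * d\<^sup>2 / (b + d\<^sup>2)"
    using * by (simp add: x_b_def field_simps)
  show ?thesis unfolding f_fun_def num den using * assms by simp
qed

text \<open>Settles the sign of the coefficient of \<open>x\<close> in the denominator of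
  \<open>f_fun\<close>: it vanishes only in the degenerate case that \<open>x_s\<close> treats
  separately.\<close>

lemma mult_le_square_coherence:
  fixes a b d :: real
  assumes "0 \<le> a" "a \<le> b" "b \<le> d"
  shows "a * b \<le> d\<^sup>2" and "\<not> (a = b \<and> b = d) \<Longrightarrow> a * b < d\<^sup>2"
proof -
  have "a * b \<le> d * d" using assms by (intro mult_mono) auto
  then show "a * b \<le> d\<^sup>2" by (simp add: power2_eq_square)
  assume ne: "\<not> (a = b \<and> b = d)"
  have "a * b < d * d"
  proof (cases "b = d")
    case True
    then have "a < d" "0 < d" using ne assms by auto
    then show ?thesis by (simp add: True)
  next
    case False
    then have "d > 0" "b < d" using assms by auto
    have "a * b \<le> d * b" using assms by (intro mult_right_mono) auto
    also have "\<dots> < d * d" using \<open>d > 0\<close> \<open>b < d\<close> by simp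
    finally show ?thesis .
  qed
  then show "a * b < d\<^sup>2" by (simp add: power2_eq_square)
qed

text \<open>If \<open>x_s\<close> is at most \<open>x_b\<close>, then \<open>x_hat\<close> is a
  minimizer among all points with positive denominator. Otherwise \<open>x_hat\<close> is
  \<open>x_b\<close>, on the decreasing branch, and is compared only with points to its left; hence
  the disjunction in the last hypothesis.\<close>

lemma x_hat_minimal:
  assumes "0 \<le> a" "a \<le> b" "b \<le> d" "0 < d"
    and pos: "0 < x * (d\<^sup>2 - a * b) + a * (1 + b)"
    and x: "x_s d a b \<le> x_b d b \<or> x \<le> x_b d b"
  shows "x_hat d a b + f_fun d a b (x_hat d a b) \<le> x + f_fun d a b x"
proof (cases "a = b \<and> b = d")
  case True
  \<comment> \<open>In the degenerate case the denominator is constant and \<open>f_fun\<close> is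
    affine with slope -1, so every point is a minimizer.\<close>
  have const: "y + f_fun d a b y = (1 + d) / d" for y
  proof -
    have "f_fun d a b y = ((1 + d) * (1 + d - y * d)) / ((1 + d) * d)"
      using True by (simp add: f_fun_def power2_eq_square algebra_simps)
    also have "\<dots> = (1 + d - y * d) / d" using \<open>0 < d\<close> by simp
    finally show ?thesis using \<open>0 < d\<close> by (simp add: field_simps)
  qed
  show ?thesis by (simp only: const order_refl)
next
  case False
  define e where "e = d\<^sup>2 - a * b"
  define s where "s = d * sqrt ((1 + a) * (1 + b))"
  define u where "u = x * e + a * (1 + b)"
  define t where "t = x_hat d a b * e + a * (1 + b)"
  have "e > 0" using mult_le_square_coherence(2)[OF assms(1-3) False] by (simp add: e_def)
  have "s > 0" using assms by (simp add: s_def)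
  have K: "d\<^sup>2 * (1 + a) * (1 + b) = s\<^sup>2"
    using assms by (simp add: s_def power_mult_distrib mult.assoc)
  have us: "x_s d a b * e + a * (1 + b) = s"
  proof -
    have "x_s d a b = (s - a - a * b) / e"
      using False by (auto simp: x_s_def s_def e_def)
    then show ?thesis using \<open>e > 0\<close> by (simp add: distrib_left)
  qed
  have ub: "x_b d b > 0" using assms by (simp add: x_b_def add_nonneg_pos)
  have "u > 0" using pos by (simp add: u_def e_def)
  have mono: "y \<le> z \<Longrightarrow> y * e + a * (1 + b) \<le> z * e + a * (1 + b)" for y z
    using \<open>e > 0\<close> by simp
  have "t > 0"
  proof (cases "x_s d a b \<le> x_b d b")
    case True
    then show ?thesis using us \<open>s > 0\<close> by (simp add: t_def x_hat_def min_def)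
  next
    case False
    then have "t = x_b d b * e + a * (1 + b)" by (simp add: t_def x_hat_def min_def)
    then show ?thesis using ub \<open>e > 0\<close> assms by (simp add: add_pos_nonneg)
  qed
  have "t = s \<or> (u \<le> t \<and> t \<le> s)"
  proof (cases "x_s d a b \<le> x_b d b")
    case True
    then show ?thesis using us by (simp add: t_def x_hat_def min_def)
  next
    case False
    then have "x \<le> x_hat d a b" "x_hat d a b \<le> x_s d a b" using x by (auto simp: x_hat_def)
    then show ?thesis using mono us unfolding u_def t_def by metis
  qed
  then have "t + s\<^sup>2 / t \<le> u + s\<^sup>2 / u"
    using \<open>u > 0\<close> \<open>t > 0\<close> by (intro add_divide_mono_below_sqrt) auto
  moreover have "x + f_fun d a b x = (u + s\<^sup>2 / u - a * (1 + b) - b * (1 + a)) / e"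
    using add_f_fun_eq[of d a b u x] \<open>u > 0\<close> \<open>e > 0\<close> K by (simp add: u_def e_def)
  moreover have "x_hat d a b + f_fun d a b (x_hat d a b)
      = (t + s\<^sup>2 / t - a * (1 + b) - b * (1 + a)) / e"
    using add_f_fun_eq[of d a b t "x_hat d a b"] \<open>t > 0\<close> \<open>e > 0\<close> K by (simp add: t_def e_def)
  ultimately show ?thesis using \<open>e > 0\<close> by (simp add: divide_right_mono)
qed

text \<open>Serves the cases in which one of the two supports alone has at least
  \<open>1 + 1 / b\<close> columns. The point \<open>1 + 1 / b\<close> is the zero of
  \<open>f_fun\<close>, so minimality applies when \<open>x_s\<close> is at most
  \<open>x_b\<close>.\<close>

lemma x_hat_le_one_plus_inverse:
  assumes "0 \<le> a" "a \<le> b" "b \<le> d" "0 < d" "0 < b"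
  shows "x_hat d a b + f_fun d a b (x_hat d a b) \<le> 1 + 1 / b"
proof (cases "x_s d a b \<le> x_b d b")
  case True
  have u: "(1 + 1 / b) * (d\<^sup>2 - a * b) + a * (1 + b) = (1 + b) * d\<^sup>2 / b"
    using \<open>0 < b\<close> by (simp add: field_simps)
  have "x_hat d a b + f_fun d a b (x_hat d a b) \<le> (1 + 1 / b) + f_fun d a b (1 + 1 / b)"
    using assms True by (intro x_hat_minimal) (auto simp: u)
  also have "f_fun d a b (1 + 1 / b) = 0"
    using \<open>0 < b\<close> by (simp add: f_fun_def field_simps)
  finally show ?thesis by simp
next
  case False
  \<comment> \<open>Now \<open>x_hat\<close> is \<open>x_b\<close>, the value to bound is
    \<open>x_b + 1\<close>, and \<open>x_b \<le> 1 / b\<close> amounts to this inequality.\<close>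
  have "b\<^sup>2 \<le> d\<^sup>2" using assms by (intro power_mono) auto
  then have "x_b d b \<le> 1 / b"
    using assms by (simp add: x_b_def field_simps power2_eq_square add_nonneg_pos)
  then show ?thesis using False f_fun_x_b[of a b d] assms by (simp add: x_hat_def min_def)
qed

lemma x_hat_le_support_sizes:
  fixes p q X Y :: real
  assumes "0 \<le> a" "a \<le> b" "b \<le> d" "0 < d" and "0 \<le> p" "0 \<le> q"
    and X: "0 < X \<Longrightarrow> 1 \<le> p" "0 \<le> X" and Y: "0 < Y \<Longrightarrow> 1 \<le> q" "0 \<le> Y" and XY: "0 < X \<or> 0 < Y"
    and ineqX: "(1 + a) * X \<le> p * (a * X + d * Y)"
    and ineqY: "(1 + b) * Y \<le> q * (b * Y + d * X)"
  shows "x_hat d a b + f_fun d a b (x_hat d a b) \<le> p + q"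
proof -
  consider (a) "1 + a \<le> a * p" | (b) "1 + b \<le> b * q"
    | (ab) "a * p < 1 + a" "b * q < 1 + b" by linarith
  then show ?thesis
  proof cases
    case a
    then have "a \<noteq> 0" using assms by auto
    then have "a > 0" "b > 0" using assms by auto
    then have "1 + 1 / a \<le> p" using a by (simp add: field_simps)
    \<comment> \<open>The ordering of \<open>a\<close> and \<open>b\<close> makes
      \<open>1 + 1 / b\<close> the weaker of the two bounds, so one lemma serves both cases.\<close>
    moreover have "1 / b \<le> 1 / a" using \<open>a > 0\<close> \<open>a \<le> b\<close> by (simp add: frac_le)
    ultimately show ?thesis using x_hat_le_one_plus_inverse[of a b d] assms \<open>b > 0\<close> by linarith
  next
    case b
    then have "b \<noteq> 0" using assms by auto
    then have "b > 0" using assms by auto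
    then have "1 + 1 / b \<le> q" using b by (simp add: field_simps)
    then show ?thesis using x_hat_le_one_plus_inverse[of a b d] assms \<open>b > 0\<close> by linarith
  next
    case ab
    have iX: "(1 + a - a * p) * X \<le> p * d * Y" using ineqX by (simp add: algebra_simps)
    have iY: "(1 + b - b * q) * Y \<le> q * d * X" using ineqY by (simp add: algebra_simps)
    \<comment> \<open>If one norm vanished, the positive factor in the other inequality would force
      the other norm to vanish too.\<close>
    have "X \<noteq> 0" using iY ab(2) XY by (auto simp: mult_le_0_iff)
    moreover have "Y \<noteq> 0" using iX ab(1) XY by (auto simp: mult_le_0_iff)
    ultimately have "X > 0" "Y > 0" using assms by auto
    then have "p \<ge> 1" "q \<ge> 1" using X Y by auto
    have "((1 + a - a * p) * X) * ((1 + b - b * q) * Y) \<le> (p * d * Y) * (q * d * X)"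
      using ab assms \<open>X > 0\<close> \<open>Y > 0\<close> by (intro mult_mono[OF iX iY]) simp_all
    then have "((1 + a - a * p) * (1 + b - b * q)) * (X * Y) \<le> (p * q * d\<^sup>2) * (X * Y)"
      by (simp add: algebra_simps power2_eq_square)
    then have pq: "(1 + a - a * p) * (1 + b - b * q) \<le> p * q * d\<^sup>2"
      using \<open>X > 0\<close> \<open>Y > 0\<close> by simp
    have e: "a * b \<le> d\<^sup>2" "\<not> (a = b \<and> b = d) \<Longrightarrow> a * b < d\<^sup>2"
      using mult_le_square_coherence[of a b d] assms by auto
    \<comment> \<open>In the degenerate case the second summand is positive since
      \<open>a = d\<close>; otherwise the first is, since \<open>q \<ge> 1\<close>.\<close>
    have u: "0 < q * (d\<^sup>2 - a * b) + a * (1 + b)"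
    proof (cases "a = b \<and> b = d")
      case True
      then have "0 < a * (1 + b)" using assms by simp
      then show ?thesis using e(1) \<open>q \<ge> 1\<close> by (simp add: add_nonneg_pos)
    next
      case False
      then show ?thesis using e(2) \<open>q \<ge> 1\<close> assms by (simp add: add_pos_nonneg)
    qed
    have "(1 + a) * (1 + b) - q * b * (1 + a) \<le> p * (q * (d\<^sup>2 - a * b) + a * (1 + b))"
      using pq by (simp add: algebra_simps)
    then have "f_fun d a b q \<le> p"
      using u by (simp add: f_fun_def pos_divide_le_eq)
    show ?thesis
    proof (cases "x_s d a b \<le> x_b d b \<or> q \<le> x_b d b")
      case True
      then have "x_hat d a b + f_fun d a b (x_hat d a b) \<le> q + f_fun d a b q"
        using x_hat_minimal[of a b d q] u assms by simp
      then show ?thesis using \<open>f_fun d a b q \<le> p\<close> by linarith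
    next
      case False
      \<comment> \<open>Beyond \<open>x_b\<close> the bound by \<open>f_fun\<close> is replaced by
        \<open>p \<ge> 1\<close>: the value at \<open>x_hat\<close> is \<open>x_b + 1\<close>, and
        \<open>x_b < q\<close>.\<close>
      then show ?thesis using f_fun_x_b[of a b d] \<open>p \<ge> 1\<close> assms by (simp add: x_hat_def min_def)
    qed
  qed
qed

subsection \<open>Coherence of a concatenation\<close>

lemma hermitian_prod_add_right: "hermitian_prod v (x + y) = hermitian_prod v x + hermitian_prod v y"
  by (simp add: hermitian_prod_def distrib_left sum.distrib)

lemma hermitian_prod_scale_right: "hermitian_prod v (c *s x) = c * hermitian_prod v x"
  by (simp add: hermitian_prod_def sum_distrib_left mult_ac)

lemma hermitian_prod_zero_right [simp]: "hermitian_prod v 0 = 0"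
  by (simp add: hermitian_prod_def)

lemma hermitian_prod_sum_right: "hermitian_prod v (\<Sum>i\<in>S. g i) = (\<Sum>i\<in>S. hermitian_prod v (g i))"
  by (induction S rule: infinite_finite_induct) (auto simp: hermitian_prod_add_right)

lemma hermitian_prod_self: "norm v = 1 \<Longrightarrow> hermitian_prod v v = 1"
proof -
  assume "norm v = 1"
  have "hermitian_prod v v = of_real (\<Sum>k\<in>UNIV. (cmod (v $ k))\<^sup>2)"
    by (simp add: hermitian_prod_def complex_norm_square mult.commute del: of_real_power)
  also have "(\<Sum>k\<in>UNIV. (cmod (v $ k))\<^sup>2) = (norm v)\<^sup>2"
    by (simp add: norm_vec_def L2_set_def sum_nonneg)
  finally show ?thesis using \<open>norm v = 1\<close> by simp
qed

lemma cmod_hermitian_prod_commute: "cmod (hermitian_prod v w) = cmod (hermitian_prod w v)"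
proof -
  have "hermitian_prod v w = cnj (hermitian_prod w v)"
    by (simp add: hermitian_prod_def mult.commute)
  then show ?thesis by simp
qed

text \<open>Pairing the relation with \<open>v i\<close> isolates \<open>x i\<close>, since
  \<open>v i\<close> has unit norm; the triangle inequality bounds the other terms, and summing over
  \<open>P\<close> produces the factor \<open>card P\<close>. Two arbitrary families allow the roles
  of the sub-dictionaries to be exchanged.\<close>

lemma sum_norm_coeffs_le:
  fixes v :: "'i \<Rightarrow> complex ^ 'm" and w :: "'j \<Rightarrow> complex ^ 'm"
  assumes "finite P" "\<And>i. i \<in> P \<Longrightarrow> norm (v i) = 1"
    and vv: "\<And>i k. i \<in> P \<Longrightarrow> k \<in> P \<Longrightarrow> i \<noteq> k \<Longrightarrow> cmod (hermitian_prod (v i) (v k)) \<le> a"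
    and vw: "\<And>i l. i \<in> P \<Longrightarrow> l \<in> Q \<Longrightarrow> cmod (hermitian_prod (v i) (w l)) \<le> d"
    and zero: "(\<Sum>k\<in>P. x k *s v k) + (\<Sum>l\<in>Q. y l *s w l) = 0"
  shows "(1 + a) * (\<Sum>k\<in>P. cmod (x k))
    \<le> card P * (a * (\<Sum>k\<in>P. cmod (x k)) + d * (\<Sum>l\<in>Q. cmod (y l)))"
proof -
  define X where "X = (\<Sum>k\<in>P. cmod (x k))"
  define Y where "Y = (\<Sum>l\<in>Q. cmod (y l))"
  have "(1 + a) * cmod (x i) \<le> a * X + d * Y" if "i \<in> P" for i
  proof -
    let ?h = hermitian_prod
    have "0 = ?h (v i) ((\<Sum>k\<in>P. x k *s v k) + (\<Sum>l\<in>Q. y l *s w l))"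
      by (simp add: zero)
    also have "\<dots> = (\<Sum>k\<in>P. x k * ?h (v i) (v k)) + (\<Sum>l\<in>Q. y l * ?h (v i) (w l))"
      by (simp add: hermitian_prod_add_right hermitian_prod_sum_right hermitian_prod_scale_right)
    also have "(\<Sum>k\<in>P. x k * ?h (v i) (v k)) = x i + (\<Sum>k\<in>P - {i}. x k * ?h (v i) (v k))"
      using that assms by (simp add: sum.remove hermitian_prod_self)
    finally have "x i + (\<Sum>k\<in>P - {i}. x k * ?h (v i) (v k)) + (\<Sum>l\<in>Q. y l * ?h (v i) (w l)) = 0"
      by simp
    then have "x i = - ((\<Sum>k\<in>P - {i}. x k * ?h (v i) (v k)) + (\<Sum>l\<in>Q. y l * ?h (v i) (w l)))"
      by (simp only: eq_neg_iff_add_eq_0 add.assoc)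
    then have "cmod (x i) \<le> cmod (\<Sum>k\<in>P - {i}. x k * ?h (v i) (v k)) + cmod (\<Sum>l\<in>Q. y l * ?h (v i) (w l))"
      by (simp only: norm_minus_cancel norm_triangle_ineq)
    also have "\<dots> \<le> (\<Sum>k\<in>P - {i}. a * cmod (x k)) + (\<Sum>l\<in>Q. d * cmod (y l))"
    proof (intro add_mono sum_norm_le)
      fix k assume "k \<in> P - {i}"
      then show "cmod (x k * ?h (v i) (v k)) \<le> a * cmod (x k)"
        using mult_right_mono[OF vv[of i k], where c = "cmod (x k)"] that by (auto simp: norm_mult mult.commute)
    next
      fix l assume "l \<in> Q"
      then show "cmod (y l * ?h (v i) (w l)) \<le> d * cmod (y l)"
        using mult_right_mono[OF vw[of i l], where c = "cmod (y l)"] that by (auto simp: norm_mult mult.commute)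
    qed
    \<comment> \<open>The missing index \<open>i\<close> is what turns the left factor into
      \<open>1 + a\<close>.\<close>
    also have "\<dots> = a * (X - cmod (x i)) + d * Y"
      using that \<open>finite P\<close> by (simp add: X_def Y_def sum_distrib_left[symmetric] sum_diff1)
    finally show ?thesis by (simp add: algebra_simps)
  qed
  then have "(\<Sum>i\<in>P. (1 + a) * cmod (x i)) \<le> (\<Sum>i\<in>P. a * X + d * Y)"
    by (rule sum_mono)
  then show ?thesis by (simp add: X_def Y_def sum_distrib_left)
qed

lemma finite_pairwise_products:
  "finite {cmod (hermitian_prod (column i D) (column j D)) | i j. i \<noteq> j}"
  by (rule finite_subset[of _ "(\<lambda>(i, j). cmod (hermitian_prod (column i D) (column j D))) ` UNIV"])
    auto

lemma hermitian_prod_le_coherence: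
  fixes D :: "complex ^ 'n ^ 'm"
  assumes "i \<noteq> j"
  shows "cmod (hermitian_prod (column i D) (column j D)) \<le> coherence D"
proof -
  have "CARD('n) \<noteq> 1" using assms by (metis card_1_singletonE UNIV_I singletonD)
  then show ?thesis
    unfolding coherence_def using assms finite_pairwise_products[of D]
    by (auto intro!: Max_ge)
qed

text \<open>The hypothesis \<open>0 \<le> B\<close> covers a single column, whose coherence is 0 by
  convention.\<close>

lemma coherence_le:
  fixes D :: "complex ^ 'n ^ 'm"
  assumes "0 \<le> B" and "\<And>i j. i \<noteq> j \<Longrightarrow> cmod (hermitian_prod (column i D) (column j D)) \<le> B"
  shows "coherence D \<le> B"
proof (cases "CARD('n) = 1")
  case True
  then show ?thesis using assms by (simp add: coherence_def)
next
  case False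
  \<comment> \<open>Two distinct indices make the set under \<open>Max\<close> nonempty.\<close>
  obtain i j :: 'n where "i \<noteq> j"
    using False card_le_Suc0_iff_eq[of "UNIV :: 'n set"] by (auto simp: le_Suc_eq)
  then have "{cmod (hermitian_prod (column i D) (column j D)) | i j. i \<noteq> j} \<noteq> {}" by blast
  then show ?thesis
    using False assms(2) finite_pairwise_products[of D] unfolding coherence_def
    by (auto intro!: Max.boundedI)
qed

lemma column_hconcat [simp]:
  "column (Inl i) (hconcat A B) = column i A"
  "column (Inr j) (hconcat A B) = column j B"
  by (simp_all add: hconcat_def column_def)

text \<open>Every product of two columns within a block is also one within the
  concatenation.\<close>

lemma coherence_hconcat_ge:
  fixes A :: "complex ^ 'p ^ 'm" and B :: "complex ^ 'q ^ 'm"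
  assumes "0 \<le> coherence (hconcat A B)"
  shows "coherence A \<le> coherence (hconcat A B)" "coherence B \<le> coherence (hconcat A B)"
proof -
  show "coherence A \<le> coherence (hconcat A B)"
  proof (rule coherence_le[OF assms])
    fix i j :: 'p assume "i \<noteq> j"
    then show "cmod (hermitian_prod (column i A) (column j A)) \<le> coherence (hconcat A B)"
      using hermitian_prod_le_coherence[of "Inl i" "Inl j" "hconcat A B"] by simp
  qed
  show "coherence B \<le> coherence (hconcat A B)"
  proof (rule coherence_le[OF assms])
    fix i j :: 'q assume "i \<noteq> j"
    then show "cmod (hermitian_prod (column i B) (column j B)) \<le> coherence (hconcat A B)"
      using hermitian_prod_le_coherence[of "Inr i" "Inr j" "hconcat A B"] by simp
  qed
qed

lemma card_dependent_columns_ge: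
  assumes "sub_dictionary A" "sub_dictionary B"
    and a: "coherence A = a" and b: "coherence B = b" and d: "coherence (hconcat A B) = d"
    and "0 \<le> a" "a \<le> b" "0 < d"
    and dep: "dependent_columns (hconcat A B) S"
  shows "x_hat d a b + f_fun d a b (x_hat d a b) \<le> card S"
proof -
  obtain c where c: "\<exists>i\<in>S. c i \<noteq> 0" "(\<Sum>i\<in>S. c i *s column i (hconcat A B)) = 0"
    using dep unfolding dependent_columns_def by blast
  define P where "P = {i. Inl i \<in> S}"
  define Q where "Q = {j. Inr j \<in> S}"
  define X where "X = (\<Sum>i\<in>P. cmod (c (Inl i)))"
  define Y where "Y = (\<Sum>j\<in>Q. cmod (c (Inr j)))"
  \<comment> \<open>Splitting the index set by block splits both its cardinality and the vanishing
    combination.\<close>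
  have S: "S = P <+> Q"
  proof (rule set_eqI)
    show "s \<in> S \<longleftrightarrow> s \<in> P <+> Q" for s by (cases s) (auto simp: P_def Q_def)
  qed
  have card: "card S = card P + card Q" by (simp add: S card_Plus)
  have zero: "(\<Sum>i\<in>P. c (Inl i) *s column i A) + (\<Sum>j\<in>Q. c (Inr j) *s column j B) = 0"
    using c(2) by (simp add: S sum.Plus)
  have cross: "cmod (hermitian_prod (column i A) (column j B)) \<le> d" for i j
    using hermitian_prod_le_coherence[of "Inl i" "Inr j" "hconcat A B"] by (simp add: d)
  have "(1 + a) * X \<le> card P * (a * X + d * Y)"
    unfolding X_def Y_def
    using assms(1) cross hermitian_prod_le_coherence[of _ _ A] zero
    by (intro sum_norm_coeffs_le) (auto simp: sub_dictionary_def a)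
  \<comment> \<open>The blocks exchange roles; the cross bound carries over because the modulus of
    the Hermitian product is symmetric.\<close>
  moreover have "(1 + b) * Y \<le> card Q * (b * Y + d * X)"
    unfolding X_def Y_def
    using assms(2) cross hermitian_prod_le_coherence[of _ _ B] zero
    by (intro sum_norm_coeffs_le)
      (auto simp: sub_dictionary_def b add.commute cmod_hermitian_prod_commute[of "column _ B" "column _ A"])
  moreover have "0 < X \<Longrightarrow> 1 \<le> real (card P)"
    by (cases "P = {}") (auto simp: X_def Suc_le_eq card_gt_0_iff)
  moreover have "0 < Y \<Longrightarrow> 1 \<le> real (card Q)"
    by (cases "Q = {}") (auto simp: Y_def Suc_le_eq card_gt_0_iff)
  moreover have "0 < X \<or> 0 < Y"
  proof -
    obtain s where s: "s \<in> S" "c s \<noteq> 0" using c(1) by blast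
    show ?thesis
    proof (cases s)
      case (Inl i)
      then have "0 < X" unfolding X_def using s by (intro sum_pos2[of P i]) (auto simp: P_def)
      then show ?thesis ..
    next
      case (Inr j)
      then have "0 < Y" unfolding Y_def using s by (intro sum_pos2[of Q j]) (auto simp: Q_def)
      then show ?thesis ..
    qed
  qed
  moreover have "b \<le> d" using coherence_hconcat_ge(2)[of A B] b d \<open>0 < d\<close> by simp
  moreover have "0 \<le> X" "0 \<le> Y" by (simp_all add: X_def Y_def sum_nonneg)
  ultimately have "x_hat d a b + f_fun d a b (x_hat d a b) \<le> real (card P) + real (card Q)"
    using assms by (intro x_hat_le_support_sizes[where X = X and Y = Y]) auto
  then show ?thesis by (simp add: card)
qed

subsection \<open>Spark\<close>

text \<open>Since \<open>enat\<close> is well-ordered, the infimum of a nonempty set is attained, so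
  a finite spark is the size of an actual dependent set.\<close>

lemma spark_cases:
  obtains "spark D = \<infinity>" | S where "dependent_columns D S" "spark D = enat (card S)"
proof (cases "\<exists>S. dependent_columns D S")
  case True
  then obtain S where "dependent_columns D S" ..
  then have "spark D \<in> (\<lambda>S. enat (card S)) ` {S. dependent_columns D S}"
    unfolding spark_def by (intro wellorder_InfI[of "enat (card S)"]) auto
  then show thesis using that(2) by auto
next
  case False
  then show thesis using that(1) by (simp add: spark_def top_enat_def)
qed

theorem theorem1:
  fixes D :: "complex ^ ('p::finite + 'q::finite) ^ 'm::finite"
    and a b d :: real
  assumes "0 \<le> a" and "a \<le> b" and "d > 0"
    and "D \<in> dictionaries d a b"
  shows "ereal_of_enat (spark D) \<ge> ereal (x_hat d a b + f_fun d a b (x_hat d a b))"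
proof (cases rule: spark_cases[of D])
  case 1
  then show ?thesis by simp
next
  case (2 S)
  obtain A :: "complex ^ 'p ^ 'm" and B :: "complex ^ 'q ^ 'm"
    where D: "D = hconcat A B" "coherence D = d"
      and AB: "sub_dictionary A" "coherence A = a" "sub_dictionary B" "coherence B = b"
    using assms(4) unfolding dictionaries_def by blast
  have "x_hat d a b + f_fun d a b (x_hat d a b) \<le> card S"
    using card_dependent_columns_ge[of A B a b d S] AB D 2(1) assms(1-3) by simp
  then show ?thesis using 2(2) by simp
qed

end
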